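(* Let $k$, $\lambda_1,\dots,\lambda_n>0$ and $\mu_1>\cdots>\mu_n>0$ be given, let the service times be exponential ($v_i=2/\mu_i^2$), and let $\alpha_1,\dots,\alpha_k>0$ with $\sum_{j=1}^k\alpha_j=1$ be given. For any optimal solution $X^*$ of the multi-queue assignment problem $$(k\text{-QAP})\qquad\inf_X f(X,\boldsymbol\alpha)\quad\text{s.t. }X\in\mathcal F_{\boldsymbol\alpha},\ \sum_{j=1}^kX_{ij}=1\ (i=1,\dots,n),\ X_{ij}\in[0,1]\ (\text{all }i,j),$$ there exist integers $0=l_0\le l_1\le l_2\le\cdots\le l_{2k-2}\le l_{2k-1}=n+1$ and $o_1,\dots,o_{2k-1}\in\{1,\dots,k\}$ such that: (i) for every $1\le h\le 2k-1$, $X^*_{i\,o_h}=1$ for all $i$ with $l_{h-1}<i<l_h$; (ii) for every $j\in\{1,\dots,k\}$: $X^*_{ij}=0$ for all $i\in\{1,\dots,n\}\setminus\bigcup_{h:\,o_h=j}\{i:l_{h-1}\le i\le l_h\}$, and $X^*_{ij}\in[0,1]$ for all $i\in\{1,\dots,n\}\cap\bigcup_{h:\,o_h=j}\{l_{h-1},l_h\}$.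
   Context: There are $n$ customer types and $k$ queues with capacities $\alpha_1,\dots,\alpha_k$. Type $i$ arrives as a Poisson process with rate $\lambda_i$ and has an exponential service time with rate $\mu_i$ under a unit-capacity server, so its second moment is $v_i=2/\mu_i^2$. $X_{ij}$ is the probability that a type $i$ customer is assigned to queue $j$. The expected waiting time is $$f(X,\boldsymbol\alpha)=\sum_{j=1}^k\left(\frac{\sum_{i}\lambda_iX_{ij}v_i}{\alpha_j^2-\alpha_j\sum_{i}\frac{\lambda_iX_{ij}}{\mu_i}}\cdot\frac{\sum_{i}X_{ij}\lambda_i}{2\sum_{i}\lambda_i}\right),$$ and $\mathcal F_{\boldsymbol\alpha}=\{X:\alpha_j>\sum_i\lambda_iX_{ij}/\mu_i,\ j=1,\dots,k\}$. *)

theory Defs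
  imports Complex_Main
begin

text \<open>
  Customer types are the indices \<open>i \<in> {1..n}\<close>, queues the indices \<open>j \<in> {1..k}\<close>. An assignment
  \<open>X\<close> is a function of both; its values outside \<open>{1..n} \<times> {1..k}\<close> are neither constrained nor used.
  \<open>lam\<close>, \<open>mu\<close>, \<open>v\<close> are the arrival rates, the service rates and the second moments of the service
  times (for a server of capacity 1), and \<open>\<alpha>\<close> are the queue capacities.
\<close>

text \<open>
  The summand for queue \<open>j\<close> is the Pollaczek--Khinchine waiting time of an M/G/1 queue with server
  capacity \<open>\<alpha> j\<close>, weighted by the fraction of all customers that are sent to that queue.
\<close>

definition expected_wait ::
  "nat \<Rightarrow> nat \<Rightarrow> (nat \<Rightarrow> real) \<Rightarrow> (nat \<Rightarrow> real) \<Rightarrow> (nat \<Rightarrow> real) \<Rightarrow> (nat \<Rightarrow> nat \<Rightarrow> real) \<Rightarrow> (nat \<Rightarrow> real) \<Rightarrow> real"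
  where
  "expected_wait n k lam mu v X \<alpha> =
     (\<Sum>j=1..k.
        (\<Sum>i=1..n. lam i * X i j * v i) /
          ((\<alpha> j)\<^sup>2 - \<alpha> j * (\<Sum>i=1..n. lam i * X i j / mu i)) *
        ((\<Sum>i=1..n. X i j * lam i) / (2 * (\<Sum>i=1..n. lam i))))"

definition stable_assignments ::
  "nat \<Rightarrow> nat \<Rightarrow> (nat \<Rightarrow> real) \<Rightarrow> (nat \<Rightarrow> real) \<Rightarrow> (nat \<Rightarrow> real) \<Rightarrow> (nat \<Rightarrow> nat \<Rightarrow> real) set"
  where
  "stable_assignments n k lam mu \<alpha> =
     {X. \<forall>j\<in>{1..k}. \<alpha> j > (\<Sum>i=1..n. lam i * X i j / mu i)}"

definition qap_feasible ::
  "nat \<Rightarrow> nat \<Rightarrow> (nat \<Rightarrow> real) \<Rightarrow> (nat \<Rightarrow> real) \<Rightarrow> (nat \<Rightarrow> real) \<Rightarrow> (nat \<Rightarrow> nat \<Rightarrow> real) \<Rightarrow> bool"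
  where
  "qap_feasible n k lam mu \<alpha> X \<longleftrightarrow>
     X \<in> stable_assignments n k lam mu \<alpha> \<and>
     (\<forall>i\<in>{1..n}. (\<Sum>j=1..k. X i j) = 1) \<and>
     (\<forall>i\<in>{1..n}. \<forall>j\<in>{1..k}. X i j \<in> {0..1})"

definition qap_optimal ::
  "nat \<Rightarrow> nat \<Rightarrow> (nat \<Rightarrow> real) \<Rightarrow> (nat \<Rightarrow> real) \<Rightarrow> (nat \<Rightarrow> real) \<Rightarrow> (nat \<Rightarrow> real) \<Rightarrow> (nat \<Rightarrow> nat \<Rightarrow> real) \<Rightarrow> bool"
  where
  "qap_optimal n k lam mu v \<alpha> X \<longleftrightarrow>
     is_arg_min (\<lambda>Y. expected_wait n k lam mu v Y \<alpha>) (qap_feasible n k lam mu \<alpha>) X"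

end

theory Submission imports Defs "HOL-Library.Product_Lexorder" begin

text \<open>
  By first-order optimality, a type \<open>i\<close> is only sent to queues \<open>j\<close> that minimise the marginal cost at
  \<open>t = 1 / mu i\<close>, which for exponential service times is a quadratic polynomial in \<open>t\<close>. So the
  assignment follows the lower envelope of \<open>k\<close> parabolas. Two distinct parabolas meet at most twice,
  hence the sequence of used queues has no alternation \<open>a \<dots> b \<dots> a \<dots> b\<close> and consists of at most
  \<open>2 * k - 1\<close> blocks (Davenport--Schinzel). Two queues with the same parabola can share only one type,
  since an exchange of two types that keeps the loads fixed would lower the cost to second order.
\<close>

section \<open>Counting the changes in a sequence without alternations\<close>

definition changes :: "'a list \<Rightarrow> nat set" where
  "changes xs = {h. Suc h < length xs \<and> xs ! h \<noteq> xs ! Suc h}"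

lemma finite_changes [simp]: "finite (changes xs)"
  by (rule finite_subset[of _ "{..<length xs}"]) (auto simp: changes_def)

lemma nth_eq_if_no_changes:
  assumes "p \<le> d" "d < length xs" "\<And>h. p \<le> h \<Longrightarrow> h < d \<Longrightarrow> h \<notin> changes xs"
  shows "xs ! p = xs ! d"
  using assms
proof (induction d rule: dec_induct)
  case (step m)
  then have "xs ! p = xs ! m" by simp
  moreover have "m \<notin> changes xs" using step by auto
  ultimately show ?case using step.prems by (auto simp: changes_def)
qed simp

text \<open>
  At a change from \<open>x\<close> to \<open>y\<close>, either \<open>x\<close> does not occur later or \<open>y\<close> does not occur earlier, since
  otherwise \<open>y, x, y, x\<close> is an alternation. Each symbol has one last and one first occurrence.
\<close>

lemma card_changes_le:
  assumes no_alternation: "\<And>p p' r r'. p < p' \<Longrightarrow> p' < r \<Longrightarrow> r < r' \<Longrightarrow> r' < length xs \<Longrightarrow>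
      xs ! p = xs ! r \<Longrightarrow> xs ! p' = xs ! r' \<Longrightarrow> xs ! p = xs ! p'"
  shows "card (changes xs) \<le> 2 * (card (set xs) - 1)"
proof (cases "xs = []")
  case True
  then show ?thesis by (simp add: changes_def)
next
  case False
  define L where "L = {h. Suc h < length xs \<and> (\<forall>r. h < r \<and> r < length xs \<longrightarrow> xs ! r \<noteq> xs ! h)}"
  define F where "F = {h. Suc h < length xs \<and> (\<forall>r\<le>h. xs ! r \<noteq> xs ! Suc h)}"
  have fin: "finite L" "finite F"
    by (rule finite_subset[of _ "{..<length xs}"]; auto simp: L_def F_def)+
  have "changes xs \<subseteq> L \<union> F"
  proof
    fix h assume h: "h \<in> changes xs"
    show "h \<in> L \<union> F"
    proof (rule ccontr)
      assume "h \<notin> L \<union> F"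
      with h obtain r r' where r: "h < r" "r < length xs" "xs ! r = xs ! h"
        and r': "r' \<le> h" "xs ! r' = xs ! Suc h"
        by (auto simp: L_def F_def changes_def)
      have "r \<noteq> Suc h" "r' \<noteq> h" using h r r' by (auto simp: changes_def)
      then have "xs ! r' = xs ! h"
        using no_alternation[of r' h "Suc h" r] r r' by auto
      then show False using h r' by (auto simp: changes_def)
    qed
  qed
  then have "card (changes xs) \<le> card (L \<union> F)" using fin by (intro card_mono) auto
  also have "\<dots> \<le> card L + card F" by (rule card_Un_le)
  \<comment> \<open>The symbol at the final position has its last occurrence there, and
    \<open>Suc h < length xs\<close> keeps that position out of \<open>L\<close>; this saves one
    symbol. Dually, the first occurrence of \<open>hd xs\<close> is never at a
    \<open>Suc h\<close>.\<close>
  also have "card L \<le> card (set xs - {last xs})"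
  proof (rule card_inj_on_le[where f = "\<lambda>h. xs ! h"])
    show "inj_on (\<lambda>h. xs ! h) L"
    proof (rule inj_onI)
      fix h h' assume "h \<in> L" "h' \<in> L" "xs ! h = xs ! h'"
      then show "h = h'" by (cases h h' rule: linorder_cases) (force simp: L_def)+
    qed
    show "(\<lambda>h. xs ! h) ` L \<subseteq> set xs - {last xs}"
    proof (intro image_subsetI DiffI)
      fix h assume "h \<in> L"
      then show "xs ! h \<in> set xs" by (auto simp: L_def)
      have "h < length xs - 1" "length xs - 1 < length xs" using \<open>h \<in> L\<close> by (auto simp: L_def)
      then have "xs ! (length xs - 1) \<noteq> xs ! h" using \<open>h \<in> L\<close> unfolding L_def by blast
      then show "xs ! h \<notin> {last xs}" using False by (auto simp: last_conv_nth)
    qed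
  qed simp
  also have "card F \<le> card (set xs - {hd xs})"
  proof (rule card_inj_on_le[where f = "\<lambda>h. xs ! Suc h"])
    show "inj_on (\<lambda>h. xs ! Suc h) F"
    proof (rule inj_onI)
      fix h h' assume "h \<in> F" "h' \<in> F" "xs ! Suc h = xs ! Suc h'"
      then show "h = h'"
        by (cases h h' rule: linorder_cases) (auto simp: F_def dest!: spec[of _ "Suc h"] spec[of _ "Suc h'"])
    qed
    show "(\<lambda>h. xs ! Suc h) ` F \<subseteq> set xs - {hd xs}"
      using False by (auto simp: F_def hd_conv_nth)
  qed simp
  finally show ?thesis using False by simp
qed

section \<open>Cutting a sorted list of pairs into blocks\<close>

text \<open>The list is cut at the changes of its second component. A first component equal to a
  boundary can occur on both sides of a cut, so only the strict interior of a block determines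
  \<open>q h\<close>, while the covering uses closed intervals.\<close>

lemma block_decomposition:
  fixes xs :: "(nat \<times> 'a) list"
  assumes sorted: "sorted (map fst xs)" and bound: "\<And>i j. (i, j) \<in> set xs \<Longrightarrow> i \<le> n"
    and "xs \<noteq> []" and card_le: "card (changes (map snd xs)) \<le> M"
  obtains l :: "nat \<Rightarrow> nat" and q :: "nat \<Rightarrow> 'a" where
    "l 0 = 0" "l (Suc M) = n + 1" "\<forall>h\<ge>1. l (h - 1) \<le> l h" "\<forall>h. q h \<in> snd ` set xs"
    "\<forall>h\<ge>1. \<forall>(i, j)\<in>set xs. l (h - 1) < i \<and> i < l h \<longrightarrow> j = q h"
    "\<forall>(i, j)\<in>set xs. \<exists>h\<in>{1..Suc M}. q h = j \<and> l (h - 1) \<le> i \<and> i \<le> l h"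
proof -
  define D where "D = changes (map snd xs)"
  define ds where "ds = sorted_list_of_set D"
  define m where "m = length ds"
  define N where "N = length xs"
  \<comment> \<open>\<open>ds\<close> is indexed from 0 and blocks from 1, hence
    \<open>h - 1\<close>. Beyond the last change the boundary is \<open>n + 1\<close>, so blocks
    after number \<open>m + 1\<close> have empty interior.\<close>
  define l where "l h = (if h = 0 then 0 else if h \<le> m then fst (xs ! (ds ! (h - 1))) else n + 1)" for h
  \<comment> \<open>\<open>e h\<close> is the position of the last entry of block \<open>h\<close>.
    The default \<open>N - 1\<close> ends the final block and keeps \<open>q h\<close> a genuine
    symbol for the surplus blocks.\<close>
  define e where "e h = (if h - 1 < m then ds ! (h - 1) else N - 1)" for h
  define q where "q h = snd (xs ! e h)" for h
  have "finite D" by (simp add: D_def)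
  then have set_ds: "set ds = D" and sorted_ds: "sorted_wrt (<) ds" and m: "m \<le> M"
    using card_le by (auto simp: ds_def m_def D_def)
  have N: "N > 0" using \<open>xs \<noteq> []\<close> by (simp add: N_def)
  have ds_D: "ds ! h \<in> D" if "h < m" for h using that set_ds by (auto simp: m_def)
  have ds_less: "Suc (ds ! h) < N" if "h < m" for h
    using ds_D[OF that] by (auto simp: D_def changes_def N_def)
  have ds_mono: "ds ! h < ds ! h'" if "h < h'" "h' < m" for h h'
    using that sorted_ds by (auto simp: m_def sorted_wrt_iff_nth_less)
  have fst_mono: "fst (xs ! p) \<le> fst (xs ! r)" if "p \<le> r" "r < N" for p r
    using sorted that by (auto simp: sorted_iff_nth_mono N_def)
  have fst_n: "fst (xs ! p) \<le> n" if "p < N" for p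
    using bound[of "fst (xs ! p)" "snd (xs ! p)"] that by (simp add: N_def)
  have e_less: "e h < N" if "1 \<le> h" for h
    using that N ds_less[of "h - 1"] by (auto simp: e_def)
  have l_prev: "h - 2 < m" "l (h - 1) = fst (xs ! (ds ! (h - 2)))" if "1 \<le> h" "h \<noteq> 1" "h \<le> Suc m" for h
  proof -
    from that have "h - 1 \<noteq> 0" "h - 1 \<le> m" "h - 1 - 1 = h - 2" by linarith+
    then show "h - 2 < m" "l (h - 1) = fst (xs ! (ds ! (h - 2)))" by (auto simp: l_def)
  qed
  have block: "snd (xs ! p) = q h"
    if h: "1 \<le> h" "h \<le> Suc m" and p: "p \<le> e h" and after: "h = 1 \<or> ds ! (h - 2) < p" for h p
  proof -
    have "map snd xs ! p = map snd xs ! e h"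
    proof (rule nth_eq_if_no_changes)
      show "e h < length (map snd xs)" using e_less h by (simp add: N_def)
      fix r assume r: "p \<le> r" "r < e h"
      show "r \<notin> changes (map snd xs)"
      proof
        assume "r \<in> changes (map snd xs)"
        then have "r \<in> set ds" by (simp add: set_ds D_def)
        then obtain g where g: "g < m" "r = ds ! g" by (auto simp: in_set_conv_nth m_def)
        \<comment> \<open>A change at or after \<open>p\<close> lies beyond the cut before block
          \<open>h\<close>, if there is one; but then it cannot come before \<open>e h\<close>,
          where the block ends.\<close>
        have "h - 1 \<le> g"
        proof (cases "h = 1")
          case False
          then have "ds ! (h - 2) < ds ! g" using after r g by auto
          moreover have "h - 2 < m" using False h by linarith
          ultimately have "\<not> g \<le> h - 2"
            using ds_mono[of g "h - 2"] False h by (cases "g = h - 2") auto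
          then show ?thesis by auto
        qed auto
        then have "h \<le> m" using g by auto
        then have "e h \<le> ds ! g"
          using \<open>h - 1 \<le> g\<close> ds_mono[of "h - 1" g] g(1) by (cases "g = h - 1") (auto simp: e_def)
        then show False using r g by auto
      qed
    qed fact
    moreover have "p < length xs" "e h < length xs"
      using p e_less[OF h(1)] by (auto simp: N_def)
    ultimately show ?thesis by (simp add: q_def)
  qed
  have ends: "l 0 = 0" "l (Suc M) = n + 1" using m by (auto simp: l_def)
  have mono: "l (h - 1) \<le> l h" if "1 \<le> h" for h
  proof -
    have "fst (xs ! (ds ! (h - 1 - 1))) \<le> fst (xs ! (ds ! (h - 1)))" if "h \<noteq> 1" "h \<le> m"
    proof -
      have "h - 1 - 1 < h - 1" "h - 1 < m" using that \<open>1 \<le> h\<close> by linarith+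
      then show ?thesis using ds_mono ds_less by (intro fst_mono) (auto simp: less_imp_le Suc_lessD)
    qed
    moreover have "fst (xs ! (ds ! (h - 1 - 1))) \<le> n + 1" if "h \<noteq> 1" "h - 1 \<le> m"
    proof -
      have "h - 1 - 1 < m" using that \<open>1 \<le> h\<close> by linarith
      then show ?thesis using ds_less fst_n by (simp add: Suc_lessD le_SucI)
    qed
    ultimately show ?thesis using that by (auto simp: l_def)
  qed
  have q_in: "q h \<in> snd ` set xs" for h
  proof -
    have "e h < N" using N ds_less[of "h - 1"] by (auto simp: e_def)
    then show ?thesis by (auto simp: q_def N_def)
  qed
  have only: "j = q h" if ij: "(i, j) \<in> set xs" and h: "1 \<le> h" and less: "l (h - 1) < i" "i < l h" for h i j
  proof -
    obtain p where p: "p < N" "xs ! p = (i, j)" using ij by (auto simp: in_set_conv_nth N_def)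
    have "h \<le> Suc m" using less bound[OF ij] h by (auto simp: l_def split: if_splits)
    moreover have "p \<le> e h"
    proof (rule ccontr)
      assume "\<not> p \<le> e h"
      then have "h \<le> m" "ds ! (h - 1) \<le> p" using p by (auto simp: e_def split: if_splits)
      then show False using fst_mono[of "ds ! (h - 1)" p] p less h by (auto simp: l_def)
    qed
    moreover have "ds ! (h - 2) < p" if "h \<noteq> 1"
    proof (rule ccontr)
      assume "\<not> ds ! (h - 2) < p"
      then have "i \<le> l (h - 1)"
        using fst_mono[of p "ds ! (h - 2)"] ds_less[of "h - 2"] p l_prev[OF h that \<open>h \<le> Suc m\<close>] by simp
      then show False using less by simp
    qed
    ultimately show ?thesis using block[of h p] h p by auto
  qed
  have cover: "\<exists>h\<in>{1..Suc M}. q h = j \<and> l (h - 1) \<le> i \<and> i \<le> l h" if ij: "(i, j) \<in> set xs" for i j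
  proof -
    obtain p where p: "p < N" "xs ! p = (i, j)" using ij by (auto simp: in_set_conv_nth N_def)
    \<comment> \<open>The block of an entry is the first one whose end reaches its position;
      minimality places the entry after the previous cut.\<close>
    define h where "h = (LEAST h. 1 \<le> h \<and> p \<le> e h)"
    have "1 \<le> Suc m \<and> p \<le> e (Suc m)" using p by (auto simp: e_def)
    then have h: "1 \<le> h" "p \<le> e h" "h \<le> Suc m"
      unfolding h_def by (metis (mono_tags, lifting) LeastI, metis (mono_tags, lifting) LeastI, rule Least_le)
    have before: "ds ! (h - 2) < p" if "h \<noteq> 1"
    proof -
      have "\<not> (1 \<le> h - 1 \<and> p \<le> e (h - 1))"
        using not_less_Least[of "h - 1" "\<lambda>h. 1 \<le> h \<and> p \<le> e h"] h that unfolding h_def by auto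
      moreover have "1 \<le> h - 1" "h - 1 - 1 = h - 2" using h(1) that by linarith+
      ultimately show ?thesis using l_prev(1)[OF h(1) that h(3)] by (simp add: e_def)
    qed
    have "q h = j" using block[of h p] h before p by auto
    moreover have "l (h - 1) \<le> i"
    proof (cases "h = 1")
      case False
      then show ?thesis
        using before h p fst_mono[of "ds ! (h - 2)" p] l_prev[OF h(1) False h(3)] by simp
    qed (simp add: l_def)
    moreover have "i \<le> l h"
    proof (cases "h \<le> m")
      case True
      then have "h - 1 < m" using h(1) by linarith
      then have "l h = fst (xs ! e h)" using True h(1) by (simp add: l_def e_def)
      then show ?thesis using h p fst_mono[of p "e h"] e_less[of h] by simp
    qed (use h bound[OF ij] in \<open>simp add: l_def\<close>)
    ultimately show ?thesis using h m by auto
  qed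
  show thesis
  proof (rule that)
    show "l 0 = 0" "l (Suc M) = n + 1" by (fact ends)+
    show "\<forall>h\<ge>1. l (h - 1) \<le> l h" using mono by simp
    show "\<forall>h. q h \<in> snd ` set xs" using q_in by simp
    show "\<forall>h\<ge>1. \<forall>(i, j)\<in>set xs. l (h - 1) < i \<and> i < l h \<longrightarrow> j = q h"
      by (auto intro: only)
    show "\<forall>(i, j)\<in>set xs. \<exists>h\<in>{1..Suc M}. q h = j \<and> l (h - 1) \<le> i \<and> i \<le> l h"
      using cover by blast
  qed
qed

section \<open>Cost of a single queue and its derivative\<close>

text \<open>\<open>a\<close>, \<open>r\<close>, \<open>b\<close>, \<open>c\<close> stand for
  capacity, arrival rate, load and the second moments weighted by arrival rates. The division by
  twice the total arrival rate, common to all queues, is left out.\<close>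

definition queue_cost :: "real \<Rightarrow> real \<Rightarrow> real \<Rightarrow> real \<Rightarrow> real" where
  "queue_cost a r b c = r * c / (a * (a - b))"

text \<open>Directional derivative of \<open>queue_cost a\<close> at \<open>(r, b, c)\<close> along
  \<open>(x, y, z)\<close>.\<close>

definition queue_cost_slope :: "real \<Rightarrow> real \<Rightarrow> real \<Rightarrow> real \<Rightarrow> real \<Rightarrow> real \<Rightarrow> real \<Rightarrow> real" where
  "queue_cost_slope a r b c x y z = (x * c + z * r) / (a * (a - b)) + y * r * c / (a * (a - b)\<^sup>2)"

lemma DERIV_queue_cost:
  assumes "a > 0" "b < a"
  shows "DERIV (\<lambda>e. queue_cost a (r + x * e) (b + y * e) (c + z * e)) 0 :> queue_cost_slope a r b c x y z"
proof -
  define d where "d = a - b"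
  have d: "d > 0" using assms by (auto simp: d_def)
  have num: "DERIV (\<lambda>e. (r + x * e) * (c + z * e)) 0 :> x * c + z * r"
    by (auto intro!: derivative_eq_intros)
  have den: "DERIV (\<lambda>e. a * (a - (b + y * e))) 0 :> - (a * y)"
    by (auto intro!: derivative_eq_intros)
  have "DERIV (\<lambda>e. (r + x * e) * (c + z * e) / (a * (a - (b + y * e)))) 0 :>
      ((x * c + z * r) * (a * d) - r * c * - (a * y)) / ((a * d) * (a * d))"
    using DERIV_divide[OF num den] assms by (simp add: d_def)
  also have "((x * c + z * r) * (a * d) - r * c * - (a * y)) / ((a * d) * (a * d))
      = (x * c + z * r) * (a * d) / ((a * d) * (a * d)) + a * (y * r * c) / (a * (a * d\<^sup>2))"
    by (simp add: add_divide_distrib power2_eq_square mult_ac)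
  also have "\<dots> = queue_cost_slope a r b c x y z"
    using assms(1) d unfolding queue_cost_slope_def d_def[symmetric] by simp
  finally show ?thesis by (simp add: queue_cost_def)
qed

text \<open>As a function of the amount \<open>e\<close> moved from the unprimed to the primed
  queue, the total cost has as its derivative at 0 the difference of the two slopes, which is
  negative.\<close>

lemma queue_cost_decrease:
  assumes "a > 0" "b < a" "a' > 0" "b' < a'"
    and less: "queue_cost_slope a' r' b' c' x y z < queue_cost_slope a r b c x y z"
  obtains d where "d > 0" "\<And>e. 0 < e \<Longrightarrow> e < d \<Longrightarrow>
    queue_cost a (r - x * e) (b - y * e) (c - z * e) + queue_cost a' (r' + x * e) (b' + y * e) (c' + z * e)
      < queue_cost a r b c + queue_cost a' r' b' c'"
proof -
  define \<phi> where "\<phi> e = queue_cost a (r - x * e) (b - y * e) (c - z * e)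
    + queue_cost a' (r' + x * e) (b' + y * e) (c' + z * e)" for e
  have "DERIV \<phi> 0 :> queue_cost_slope a r b c (- x) (- y) (- z) + queue_cost_slope a' r' b' c' x y z"
    unfolding \<phi>_def using DERIV_queue_cost[of a b r "- x" "- y" c "- z"] DERIV_queue_cost[of a' b' r' x y c' z] assms
    by (intro DERIV_add) simp_all
  moreover have "queue_cost_slope a r b c (- x) (- y) (- z) = - queue_cost_slope a r b c x y z"
  proof -
    have "- x * c + - z * r = - (x * c + z * r)" by simp
    then show ?thesis unfolding queue_cost_slope_def by (simp only: minus_divide_left[symmetric])
  qed
  ultimately have "DERIV \<phi> 0 :> queue_cost_slope a' r' b' c' x y z - queue_cost_slope a r b c x y z"
    by simp
  from DERIV_neg_dec_right[OF this] less
  obtain d where "d > 0" "\<And>h. 0 < h \<Longrightarrow> h < d \<Longrightarrow> \<phi> h < \<phi> 0" by auto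
  then show thesis by (intro that[of d]) (auto simp: \<phi>_def)
qed

lemma sum_fun_split_2:
  fixes f g :: "'a \<Rightarrow> 'b::comm_monoid_add"
  assumes "finite A" "a \<in> A" "b \<in> A" "a \<noteq> b"
  shows "sum f A = f a + f b + sum f (A - {a, b})"
proof -
  have "sum f A = sum f {a, b} + sum f (A - {a, b})"
    using assms by (simp add: sum.subset_diff[of "{a, b}" A f] add.commute)
  then show ?thesis using assms by simp
qed

section \<open>Optimal assignments and transfers between two queues\<close>

locale optimal_assignment =
  fixes n k :: nat and lam mu v \<alpha> :: "nat \<Rightarrow> real" and X :: "nat \<Rightarrow> nat \<Rightarrow> real"
  assumes lam_pos: "i \<in> {1..n} \<Longrightarrow> lam i > 0"
    and mu_pos: "i \<in> {1..n} \<Longrightarrow> mu i > 0"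
    and mu_less: "\<lbrakk>i \<in> {1..n}; i' \<in> {1..n}; i < i'\<rbrakk> \<Longrightarrow> mu i' < mu i"
    and v_eq: "i \<in> {1..n} \<Longrightarrow> v i = 2 / (mu i)\<^sup>2"
    and alpha_pos: "j \<in> {1..k} \<Longrightarrow> \<alpha> j > 0"
    and optimal: "qap_optimal n k lam mu v \<alpha> X"
begin

definition "arrivals Y j = (\<Sum>i=1..n. lam i * Y i j)"
definition "load Y j = (\<Sum>i=1..n. lam i * Y i j / mu i)"
definition "moment Y j = (\<Sum>i=1..n. lam i * Y i j * v i)"
definition "cost Y j = queue_cost (\<alpha> j) (arrivals Y j) (load Y j) (moment Y j)"

lemma expected_wait_eq:
  "expected_wait n k lam mu v Y \<alpha> = (\<Sum>j=1..k. cost Y j) / (2 * (\<Sum>i=1..n. lam i))"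
proof -
  have "(\<Sum>i=1..n. Y i j * lam i) = arrivals Y j" for j
    by (simp add: arrivals_def mult.commute)
  then show ?thesis
    unfolding expected_wait_def sum_divide_distrib[where A = "{1..k}"] cost_def queue_cost_def
    by (intro sum.cong refl) (simp add: load_def moment_def power2_eq_square right_diff_distrib mult.commute)
qed

lemma feasible: "qap_feasible n k lam mu \<alpha> X"
  and minimal: "qap_feasible n k lam mu \<alpha> Y \<Longrightarrow>
    expected_wait n k lam mu v X \<alpha> \<le> expected_wait n k lam mu v Y \<alpha>"
  using optimal by (auto simp: qap_optimal_def is_arg_min_linorder)

lemma row_sum: "i \<in> {1..n} \<Longrightarrow> (\<Sum>j=1..k. X i j) = 1"
  and X_nonneg: "i \<in> {1..n} \<Longrightarrow> j \<in> {1..k} \<Longrightarrow> X i j \<ge> 0"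
  and X_le_1: "i \<in> {1..n} \<Longrightarrow> j \<in> {1..k} \<Longrightarrow> X i j \<le> 1"
  and load_less: "j \<in> {1..k} \<Longrightarrow> load X j < \<alpha> j"
  using feasible by (auto simp: qap_feasible_def stable_assignments_def load_def)

text \<open>\<open>\<delta> i\<close> is the share of type \<open>i\<close> moved from
  \<open>j\<close> to \<open>j'\<close>, negative for a move back. The result is feasible, so
  optimality compares the total costs, in which all other queues cancel.\<close>

lemma transfer_not_better:
  fixes \<delta> :: "nat \<Rightarrow> real"
  defines "x \<equiv> \<Sum>i=1..n. lam i * \<delta> i" and "y \<equiv> \<Sum>i=1..n. lam i * \<delta> i / mu i"
    and "z \<equiv> \<Sum>i=1..n. lam i * \<delta> i * v i"
  assumes j: "j \<in> {1..k}" "j' \<in> {1..k}" "j \<noteq> j'" and n: "n > 0"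
    and \<delta>: "\<And>i. i \<in> {1..n} \<Longrightarrow> - X i j' \<le> \<delta> i \<and> \<delta> i \<le> X i j"
    and stable: "load X j - y < \<alpha> j" "load X j' + y < \<alpha> j'"
  shows "cost X j + cost X j' \<le>
    queue_cost (\<alpha> j) (arrivals X j - x) (load X j - y) (moment X j - z)
    + queue_cost (\<alpha> j') (arrivals X j' + x) (load X j' + y) (moment X j' + z)"
proof -
  define Y where "Y i = (X i)(j := X i j - \<delta> i, j' := X i j' + \<delta> i)" for i
  have sums: "arrivals Y j = arrivals X j - x" "arrivals Y j' = arrivals X j' + x"
    "load Y j = load X j - y" "load Y j' = load X j' + y"
    "moment Y j = moment X j - z" "moment Y j' = moment X j' + z"
    using j by (simp_all add: Y_def arrivals_def load_def moment_def x_def y_def z_def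
        algebra_simps add_divide_distrib diff_divide_distrib sum.distrib sum_subtractf)
  have other: "load Y m = load X m" "cost Y m = cost X m" if "m \<noteq> j" "m \<noteq> j'" for m
    using that by (simp_all add: Y_def cost_def arrivals_def load_def moment_def)
  have Y_sum: "(\<Sum>m=1..k. Y i m) = 1" if "i \<in> {1..n}" for i
  proof -
    have "sum (Y i) ({1..k} - {j, j'}) = sum (X i) ({1..k} - {j, j'})"
      by (intro sum.cong) (auto simp: Y_def)
    then show ?thesis
      using row_sum[OF that] j sum_fun_split_2[of "{1..k}" j j' "Y i"] sum_fun_split_2[of "{1..k}" j j' "X i"]
      by (auto simp: Y_def)
  qed
  have Y_nonneg: "Y i m \<ge> 0" if "i \<in> {1..n}" "m \<in> {1..k}" for i m
    using \<delta>[OF that(1)] X_nonneg[OF that] by (auto simp: Y_def)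
  \<comment> \<open>The bounds on \<open>\<delta>\<close> only secure nonnegativity; the upper bound
    1 then follows from the row sum.\<close>
  have "Y i m \<le> 1" if "i \<in> {1..n}" "m \<in> {1..k}" for i m
    using member_le_sum[of m "{1..k}" "Y i"] Y_nonneg[OF that(1)] Y_sum[OF that(1)] that by auto
  moreover have "load Y m < \<alpha> m" if "m \<in> {1..k}" for m
    using stable sums other[of m] load_less[OF that] by (cases "m = j \<or> m = j'") auto
  ultimately have "qap_feasible n k lam mu \<alpha> Y"
    using Y_sum Y_nonneg by (auto simp: qap_feasible_def stable_assignments_def load_def)
  moreover have "0 < (\<Sum>i=1..n. lam i)" using n lam_pos by (intro sum_pos) auto
  ultimately have "(\<Sum>m=1..k. cost X m) \<le> (\<Sum>m=1..k. cost Y m)"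
    using minimal[of Y] by (simp add: expected_wait_eq divide_le_cancel)
  moreover have "sum (cost Y) ({1..k} - {j, j'}) = sum (cost X) ({1..k} - {j, j'})"
    using other by (intro sum.cong) auto
  ultimately have "cost X j + cost X j' \<le> cost Y j + cost Y j'"
    using j sum_fun_split_2[of "{1..k}" j j' "cost X"] sum_fun_split_2[of "{1..k}" j j' "cost Y"] by auto
  then show ?thesis by (simp add: cost_def sums)
qed

section \<open>Marginal costs and the first-order condition\<close>

text \<open>Coefficients of the slope along \<open>(1, t, 2 * t\<^sup>2)\<close>: a unit flow of a
  type with mean service time \<open>t\<close> adds \<open>t\<close> to the load and, for
  exponential service, \<open>2 * t\<^sup>2\<close> to the moment.\<close>

definition "c2 j = 2 * arrivals X j / (\<alpha> j * (\<alpha> j - load X j))"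
definition "c1 j = arrivals X j * moment X j / (\<alpha> j * (\<alpha> j - load X j)\<^sup>2)"
definition "c0 j = moment X j / (\<alpha> j * (\<alpha> j - load X j))"
definition "marginal j t = c2 j * t\<^sup>2 + c1 j * t + c0 j"

lemma sum_single_type:
  fixes g :: "nat \<Rightarrow> real"
  assumes "i \<in> {1..n}"
  shows "(\<Sum>m=1..n. lam m * (if m = i then e else 0) * g m) = lam i * e * g i"
proof -
  have "(\<Sum>m=1..n. lam m * (if m = i then e else 0) * g m) = (\<Sum>m=1..n. if m = i then lam i * e * g i else 0)"
    by (intro sum.cong) auto
  then show ?thesis using assms by simp
qed

text \<open>Otherwise shifting a little of type \<open>i\<close> from \<open>j\<close> to
  \<open>j'\<close> would lower the cost; \<open>X i j > 0\<close> makes room for the shift.\<close>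

lemma marginal_le:
  assumes i: "i \<in> {1..n}" and j: "j \<in> {1..k}" "j' \<in> {1..k}" and pos: "X i j > 0"
  shows "marginal j (1 / mu i) \<le> marginal j' (1 / mu i)"
proof (rule ccontr)
  assume not: "\<not> ?thesis"
  then have "j \<noteq> j'" by auto
  have mu: "mu i > 0" and lam: "lam i > 0" using i mu_pos lam_pos by auto
  let ?x = "lam i" and ?y = "lam i / mu i" and ?z = "lam i * v i"
  have slope: "queue_cost_slope (\<alpha> m) (arrivals X m) (load X m) (moment X m) ?x ?y ?z
      = lam i * marginal m (1 / mu i)" for m
    using v_eq[OF i] by (simp add: queue_cost_slope_def marginal_def c2_def c1_def c0_def
        add_divide_distrib algebra_simps power_divide)
  obtain d where "d > 0" and d: "\<And>e. 0 < e \<Longrightarrow> e < d \<Longrightarrow>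
      queue_cost (\<alpha> j) (arrivals X j - ?x * e) (load X j - ?y * e) (moment X j - ?z * e)
      + queue_cost (\<alpha> j') (arrivals X j' + ?x * e) (load X j' + ?y * e) (moment X j' + ?z * e)
      < cost X j + cost X j'"
    using queue_cost_decrease[of "\<alpha> j" "load X j" "\<alpha> j'" "load X j'" "arrivals X j'" "moment X j'" ?x ?y ?z
        "arrivals X j" "moment X j"] alpha_pos load_less j not lam
    unfolding slope cost_def by auto
  \<comment> \<open>The three bounds keep \<open>e\<close> within the range of descent, the
    remaining share at \<open>j\<close> nonnegative, and at least half of the slack of queue
    \<open>j'\<close> free.\<close>
  define e where "e = min (d / 2) (min (X i j) ((\<alpha> j' - load X j') / (2 * ?y)))"
  have e: "0 < e" "e < d" "e \<le> X i j" "e \<le> (\<alpha> j' - load X j') / (2 * ?y)"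
    using \<open>d > 0\<close> pos mu lam load_less[OF j(2)] by (auto simp: e_def)
  have "?y * e \<le> (\<alpha> j' - load X j') / 2" using e(4) mu lam by (simp add: field_simps)
  moreover have "0 < ?y * e" using e(1) mu lam by simp
  ultimately have stable: "load X j' + ?y * e < \<alpha> j' \<and> load X j - ?y * e < \<alpha> j"
    using load_less[OF j(1)] load_less[OF j(2)] by argo
  let ?\<delta> = "\<lambda>m. if m = i then e else 0"
  have "(\<Sum>m=1..n. lam m * ?\<delta> m) = ?x * e" "(\<Sum>m=1..n. lam m * ?\<delta> m / mu m) = ?y * e"
    "(\<Sum>m=1..n. lam m * ?\<delta> m * v m) = ?z * e"
    using sum_single_type[OF i, of e "\<lambda>_. 1"] sum_single_type[OF i, of e "\<lambda>m. 1 / mu m"]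
      sum_single_type[OF i, of e v] by (simp_all add: mult_ac)
  moreover have "- X m j' \<le> ?\<delta> m \<and> ?\<delta> m \<le> X m j" if "m \<in> {1..n}" for m
    using e X_nonneg[OF that j(1)] X_nonneg[OF that j(2)] by auto
  ultimately have "cost X j + cost X j' \<le> queue_cost (\<alpha> j) (arrivals X j - ?x * e) (load X j - ?y * e) (moment X j - ?z * e)
      + queue_cost (\<alpha> j') (arrivals X j' + ?x * e) (load X j' + ?y * e) (moment X j' + ?z * e)"
    using transfer_not_better[of j j' ?\<delta>] j \<open>j \<noteq> j'\<close> stable i by auto
  with d[OF e(1,2)] show False by simp
qed

text \<open>
  Types \<open>i\<close> and \<open>i'\<close> are exchanged between the queues so that both loads stay the same. Then the cost
  is a quadratic function of the amount exchanged; its linear terms cancel and its leading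
  coefficient is negative.
\<close>

lemma equal_marginals_unique_type:
  assumes i: "i \<in> {1..n}" "i' \<in> {1..n}" and j: "j \<in> {1..k}" "j' \<in> {1..k}" "j \<noteq> j'"
    and pos: "X i j > 0" "X i' j' > 0" and eq: "c2 j = c2 j'" "c0 j = c0 j'"
  shows "i = i'"
proof (rule ccontr)
  assume "i \<noteq> i'"
  define s t where "s = 1 / mu i" and "t = 1 / mu i'"
  have mu: "mu i > 0" "mu i' > 0" and lam: "lam i > 0" "lam i' > 0" using i mu_pos lam_pos by auto
  have "mu i \<noteq> mu i'" using mu_less[of i i'] mu_less[of i' i] i \<open>i \<noteq> i'\<close> by (cases "i < i'") auto
  then have "s \<noteq> t" "s > 0" "t > 0" using mu by (auto simp: s_def t_def)
  \<comment> \<open>The largest exchange for which both reduced shares stay nonnegative.\<close>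
  define e where "e = min (X i j * lam i / t) (X i' j' * lam i' / s)"
  have e: "e > 0" "e * t / lam i \<le> X i j" "e * s / lam i' \<le> X i' j'"
  proof -
    show "e > 0" using pos lam \<open>s > 0\<close> \<open>t > 0\<close> by (simp add: e_def)
    have "e \<le> X i j * lam i / t" "e \<le> X i' j' * lam i' / s" by (simp_all add: e_def)
    then show "e * t / lam i \<le> X i j" "e * s / lam i' \<le> X i' j'"
      using lam \<open>s > 0\<close> \<open>t > 0\<close> by (simp_all add: field_simps)
  qed
  \<comment> \<open>Type \<open>i\<close> carries load \<open>s\<close> per unit of flow and type
    \<open>i'\<close> carries \<open>t\<close>, so flows \<open>e * t\<close> and
    \<open>e * s\<close> in opposite directions balance the loads.\<close>
  define \<delta> where "\<delta> m = (if m = i then e * t / lam i else 0) + (if m = i' then - (e * s / lam i') else 0)" for m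
  have sum_\<delta>: "(\<Sum>m=1..n. lam m * \<delta> m * g m) = e * (t * g i - s * g i')" for g :: "nat \<Rightarrow> real"
  proof -
    have "(\<Sum>m=1..n. lam m * \<delta> m * g m) = lam i * (e * t / lam i) * g i + lam i' * (- (e * s / lam i')) * g i'"
      using sum_single_type[OF i(1), of _ g] sum_single_type[OF i(2), of _ g]
      unfolding \<delta>_def by (simp add: distrib_left distrib_right sum.distrib del: mult_minus_right)
    then show ?thesis using lam by (simp add: algebra_simps)
  qed
  define x z where "x = e * (t - s)" and "z = e * (2 * s * t * (s - t))"
  have sums: "(\<Sum>m=1..n. lam m * \<delta> m) = x" "(\<Sum>m=1..n. lam m * \<delta> m / mu m) = 0"
    "(\<Sum>m=1..n. lam m * \<delta> m * v m) = z"
  proof -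
    show "(\<Sum>m=1..n. lam m * \<delta> m) = x" using sum_\<delta>[of "\<lambda>_. 1"] by (simp add: x_def)
    show "(\<Sum>m=1..n. lam m * \<delta> m / mu m) = 0" using sum_\<delta>[of "\<lambda>m. 1 / mu m"] by (simp add: s_def t_def)
    have "v i = 2 * s\<^sup>2" "v i' = 2 * t\<^sup>2" using v_eq i by (simp_all add: s_def t_def power_divide)
    then show "(\<Sum>m=1..n. lam m * \<delta> m * v m) = z"
      using sum_\<delta>[of v] by (simp add: z_def algebra_simps power2_eq_square)
  qed
  have "0 \<le> e * t / lam i" "0 \<le> e * s / lam i'"
    using e(1) lam \<open>s > 0\<close> \<open>t > 0\<close> by simp_all
  then have "- X m j' \<le> \<delta> m \<and> \<delta> m \<le> X m j" if "m \<in> {1..n}" for m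
    using e X_nonneg[OF that j(1)] X_nonneg[OF that j(2)] \<open>i \<noteq> i'\<close> by (auto simp: \<delta>_def)
  then have le: "cost X j + cost X j' \<le>
      queue_cost (\<alpha> j) (arrivals X j - x) (load X j) (moment X j - z)
      + queue_cost (\<alpha> j') (arrivals X j' + x) (load X j') (moment X j' + z)"
    using transfer_not_better[of j j' \<delta>] sums j load_less i by auto
  define K K' where "K = \<alpha> j * (\<alpha> j - load X j)" and "K' = \<alpha> j' * (\<alpha> j' - load X j')"
  have K: "K > 0" "K' > 0" using alpha_pos load_less j by (auto simp: K_def K'_def)
  \<comment> \<open>With unchanged loads the denominators \<open>K\<close> and \<open>K'\<close> are
    fixed, and equality of \<open>c2\<close> and of \<open>c0\<close> is what makes the linear terms
    of the two queues cancel.\<close>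
  have lin: "arrivals X j / K = arrivals X j' / K'" "moment X j / K = moment X j' / K'"
    using eq by (auto simp: c2_def c0_def K_def K'_def)
  have expand: "(a - x) * (c - z) / p = a * c / p - x * (c / p) - z * (a / p) + x * z / p"
    "(a + x) * (c + z) / p = a * c / p + x * (c / p) + z * (a / p) + x * z / p" for a c p
    by (simp_all add: algebra_simps add_divide_distrib diff_divide_distrib)
  have "0 \<le> x * z / K + x * z / K'"
    using le lin unfolding cost_def queue_cost_def K_def[symmetric] K'_def[symmetric] expand by simp
  moreover have "x * z < 0"
  proof -
    have "x * z = - (2 * s * t * (e * (s - t))\<^sup>2)"
      by (simp add: x_def z_def power2_eq_square algebra_simps)
    then show ?thesis using \<open>s \<noteq> t\<close> \<open>s > 0\<close> \<open>t > 0\<close> e(1) by simp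
  qed
  ultimately show False using divide_neg_pos[OF _ K(1)] divide_neg_pos[OF _ K(2)] by fastforce
qed

section \<open>Ordering the support and excluding alternations\<close>

definition "support = {(i, j). i \<in> {1..n} \<and> j \<in> {1..k} \<and> X i j > 0}"

text \<open>
  Queues that share a type \<open>i\<close> are listed by decreasing derivative of their marginal cost at
  \<open>1 / mu i\<close>, the order in which the lower envelope would use them around that point.
\<close>

definition "key p = (fst p, - (2 * c2 (snd p) * (1 / mu (fst p)) + c1 (snd p)))"

text \<open>
  The left-hand side is the divided difference of \<open>marginal a - marginal b\<close> between the two points,
  and its derivative if they coincide. This treats ties and crossings alike.
\<close>

lemma key_le_imp:
  assumes p: "(i, a) \<in> support" "(i', b) \<in> support" and le: "key (i, a) \<le> key (i', b)"
  shows "(c2 a - c2 b) * (1 / mu i + 1 / mu i') + (c1 a - c1 b) \<ge> 0"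
proof (cases "i = i'")
  case True
  then show ?thesis using le by (simp add: key_def less_eq_prod_def algebra_simps add_divide_distrib)
next
  case False
  then have "i < i'" using le by (auto simp: key_def less_eq_prod_def)
  define s t where "s = 1 / mu i" and "t = 1 / mu i'"
  have "s < t" using mu_less[of i i'] mu_pos[of i'] p \<open>i < i'\<close>
    by (auto simp: s_def t_def support_def intro: divide_strict_left_mono)
  have "marginal a s \<le> marginal b s" "marginal b t \<le> marginal a t"
    using p by (auto simp: s_def t_def support_def intro!: marginal_le)
  then have "0 \<le> (t - s) * ((c2 a - c2 b) * (s + t) + (c1 a - c1 b))"
    by (simp add: marginal_def algebra_simps power2_eq_square)
  then show ?thesis using \<open>s < t\<close> by (simp add: s_def t_def zero_le_mult_iff)
qed

text \<open>The sign conditions from \<open>key_le_imp\<close> alternate: adding consecutive ones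
  bounds \<open>c2 a - c2 b\<close> by 0 from both sides, and then \<open>c1\<close> and
  \<open>c0\<close> agree as well. Two queues with the same parabola serve one and the same single
  type, but \<open>a\<close> serves both \<open>i1\<close> and \<open>i3\<close>.\<close>

lemma no_alternation:
  assumes p: "(i1, a) \<in> support" "(i2, b) \<in> support" "(i3, a) \<in> support" "(i4, b) \<in> support"
    and le: "key (i1, a) \<le> key (i2, b)" "key (i2, b) \<le> key (i3, a)" "key (i3, a) \<le> key (i4, b)"
    and ne: "i1 \<noteq> i3" "i2 \<noteq> i4"
  shows "a = b"
proof (rule ccontr)
  assume "a \<noteq> b"
  define r where "r i = 1 / mu i" for i
  have less: "i1 < i3" "i2 < i4"
    using le ne by (auto simp: key_def less_eq_prod_def)
  have r: "r i1 < r i3" "r i2 < r i4"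
    using mu_less[of i1 i3] mu_less[of i2 i4] mu_pos[of i3] mu_pos[of i4] p less
    by (auto simp: r_def support_def intro: divide_strict_left_mono)
  have 1: "(c2 a - c2 b) * (r i1 + r i2) + (c1 a - c1 b) \<ge> 0"
    and 2: "(c2 b - c2 a) * (r i2 + r i3) + (c1 b - c1 a) \<ge> 0"
    and 3: "(c2 a - c2 b) * (r i3 + r i4) + (c1 a - c1 b) \<ge> 0"
    using key_le_imp p le unfolding r_def by blast+
  have "(c2 a - c2 b) * (r i1 - r i3) \<ge> 0" using 1 2 by (simp add: algebra_simps)
  moreover have "(c2 a - c2 b) * (r i4 - r i2) \<ge> 0" using 2 3 by (simp add: algebra_simps)
  ultimately have c2: "c2 a = c2 b" using r by (auto simp: zero_le_mult_iff)
  then have "c1 a = c1 b" using 1 2 by simp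
  moreover have "marginal a (r i1) \<le> marginal b (r i1)" "marginal b (r i2) \<le> marginal a (r i2)"
    using p by (auto simp: r_def support_def intro!: marginal_le)
  ultimately have c0: "c0 a = c0 b" using c2 by (simp add: marginal_def)
  have "i1 = i2" "i3 = i2"
    using equal_marginals_unique_type[of _ i2 a b] p c2 c0 \<open>a \<noteq> b\<close> by (auto simp: support_def)
  then show False using ne by simp
qed

lemma obtain_sorted_support:
  obtains xs where "set xs = support" "sorted (map fst xs)"
    "card (changes (map snd xs)) \<le> 2 * (k - 1)"
proof -
  have "support \<subseteq> {1..n} \<times> {1..k}" by (auto simp: support_def)
  then have "finite support" by (rule finite_subset) auto
  then obtain ys where ys: "set ys = support" "distinct ys" using finite_distinct_list by blast
  define xs where "xs = sort_key key ys"
  have xs: "set xs = support" "distinct xs" "sorted (map key xs)" using ys by (auto simp: xs_def)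
  have key_le: "key (xs ! p) \<le> key (xs ! r)" if "p \<le> r" "r < length xs" for p r
    using xs(3) that by (auto simp: sorted_iff_nth_mono)
  \<comment> \<open>\<open>key\<close> is compared lexicographically with the type first, so sorting
    by it also sorts the types.\<close>
  have "sorted (map fst xs)"
    unfolding sorted_iff_nth_mono using key_le by (force simp: key_def less_eq_prod_def)
  moreover have "card (changes (map snd xs)) \<le> 2 * (card (set (map snd xs)) - 1)"
  proof (rule card_changes_le)
    fix p1 p2 p3 p4
    assume less: "p1 < p2" "p2 < p3" "p3 < p4" "p4 < length (map snd xs)"
      and eq: "map snd xs ! p1 = map snd xs ! p3" "map snd xs ! p2 = map snd xs ! p4"
    \<comment> \<open>Distinct pairs with the same queue differ in their type, as
      \<open>no_alternation\<close> requires.\<close>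
    have distinct: "xs ! p1 \<noteq> xs ! p3" "xs ! p2 \<noteq> xs ! p4"
      using xs(2) less by (auto simp: nth_eq_iff_index_eq)
    obtain i1 a where 1: "xs ! p1 = (i1, a)" by fastforce
    obtain i2 b where 2: "xs ! p2 = (i2, b)" by fastforce
    obtain i3 where 3: "xs ! p3 = (i3, a)" using eq less 1 by (cases "xs ! p3") auto
    obtain i4 where 4: "xs ! p4 = (i4, b)" using eq less 2 by (cases "xs ! p4") auto
    have "xs ! p1 \<in> support" "xs ! p2 \<in> support" "xs ! p3 \<in> support" "xs ! p4 \<in> support"
      using less by (auto simp: xs(1)[symmetric])
    moreover have "key (xs ! p1) \<le> key (xs ! p2)" "key (xs ! p2) \<le> key (xs ! p3)" "key (xs ! p3) \<le> key (xs ! p4)"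
      using key_le less by auto
    ultimately have "a = b"
      using no_alternation[of i1 a i2 b i3 i4] distinct unfolding 1 2 3 4 by auto
    then show "map snd xs ! p1 = map snd xs ! p2" using 1 2 less by auto
  qed
  moreover have "card (set (map snd xs)) \<le> card {1..k}"
    using xs(1) by (intro card_mono) (auto simp: support_def)
  ultimately show thesis using xs(1) by (intro that[of xs]) auto
qed

end

section \<open>Block structure of an optimal assignment\<close>

theorem theorem5:
  fixes n k :: nat
    and lam mu v \<alpha> :: "nat \<Rightarrow> real"
    and X :: "nat \<Rightarrow> nat \<Rightarrow> real"
  assumes lam_pos: "\<forall>i\<in>{1..n}. lam i > 0"
    and mu_decreasing: "strict_antimono_on {1..n} mu"
    and mu_pos: "\<forall>i\<in>{1..n}. mu i > 0"
    and v_exponential: "\<forall>i\<in>{1..n}. v i = 2 / (mu i)\<^sup>2"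
    and alpha_pos: "\<forall>j\<in>{1..k}. \<alpha> j > 0"
    and alpha_sum: "(\<Sum>j=1..k. \<alpha> j) = 1"
    and optimal: "qap_optimal n k lam mu v \<alpha> X"
  shows "\<exists>(l :: nat \<Rightarrow> nat) (q :: nat \<Rightarrow> nat).
     l 0 = 0 \<and> l (2 * k - 1) = n + 1 \<and>
     (\<forall>h\<in>{1..2 * k - 1}. l (h - 1) \<le> l h) \<and>
     (\<forall>h\<in>{1..2 * k - 1}. q h \<in> {1..k}) \<and>
     (\<forall>h\<in>{1..2 * k - 1}. \<forall>i. l (h - 1) < i \<and> i < l h \<longrightarrow> X i (q h) = 1) \<and>
     (\<forall>j\<in>{1..k}.
        (\<forall>i\<in>{1..n} - (\<Union>h\<in>{h\<in>{1..2 * k - 1}. q h = j}. {l (h - 1)..l h}). X i j = 0) \<and>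
        (\<forall>i\<in>{1..n} \<inter> (\<Union>h\<in>{h\<in>{1..2 * k - 1}. q h = j}. {l (h - 1), l h}). X i j \<in> {0..1}))"
proof -
  interpret optimal_assignment n k lam mu v \<alpha> X
    using assms by unfold_locales (auto simp: monotone_on_def)
  have k: "k \<ge> 1" using alpha_sum by (cases k) auto
  show ?thesis
  proof (cases "n = 0")
    case True
    \<comment> \<open>Without types, the boundaries 0 and \<open>n + 1 = 1\<close> leave no index
      strictly between them.\<close>
    then show ?thesis
      using k by (intro exI[of _ "\<lambda>h. if h = 0 then 0 else 1"] exI[of _ "\<lambda>_. 1"]) auto
  next
    case False
    obtain xs where xs: "set xs = support" "sorted (map fst xs)"
      "card (changes (map snd xs)) \<le> 2 * (k - 1)" by (rule obtain_sorted_support)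
    have covered: "\<exists>j\<in>{1..k}. X i j > 0" if "i \<in> {1..n}" for i
    proof (rule ccontr)
      assume "\<not> ?thesis"
      then have "(\<Sum>j=1..k. X i j) \<le> 0" by (intro sum_nonpos) (auto simp: not_less)
      then show False using row_sum[OF that] by simp
    qed
    have nonempty: "xs \<noteq> []" using covered[of 1] False xs(1) by (auto simp: support_def)
    have bound: "i \<le> n" if "(i, j) \<in> set xs" for i j using that xs(1) by (auto simp: support_def)
    obtain l q where l: "l 0 = 0" "l (Suc (2 * (k - 1))) = n + 1"
      "\<forall>h\<ge>1. l (h - 1) \<le> l h" "\<forall>h. q h \<in> snd ` set xs"
      and only: "\<forall>h\<ge>1. \<forall>(i, j)\<in>set xs. l (h - 1) < i \<and> i < l h \<longrightarrow> j = q h"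
      and cover: "\<forall>(i, j)\<in>set xs. \<exists>h\<in>{1..Suc (2 * (k - 1))}. q h = j \<and> l (h - 1) \<le> i \<and> i \<le> l h"
      by (rule block_decomposition[OF xs(2) bound nonempty xs(3)])
    have k_eq: "Suc (2 * (k - 1)) = 2 * k - 1" using k by auto
    have q: "q h \<in> {1..k}" for h using l(4) xs(1) by (auto simp: support_def)
    have mono: "l h \<le> l (Suc h)" for h using l(3)[rule_format, of "Suc h"] by simp
    have l_le: "l h \<le> n + 1" if "h \<le> 2 * k - 1" for h
      using lift_Suc_mono_le[of l, OF mono that] l(2) unfolding k_eq by simp
    have full: "X i (q h) = 1" if h: "h \<in> {1..2 * k - 1}" and i: "l (h - 1) < i" "i < l h" for h i
    proof -
      have "i \<in> {1..n}" using i l_le[of h] h by auto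
      \<comment> \<open>A positive share at another queue would be a support entry strictly inside
        block \<open>h\<close>, against \<open>only\<close>; hence the whole row sum 1 falls on
        \<open>q h\<close>.\<close>
      have "X i j = 0" if "j \<in> {1..k} - {q h}" for j
      proof (rule ccontr)
        assume "X i j \<noteq> 0"
        then have "(i, j) \<in> set xs"
          using X_nonneg[OF \<open>i \<in> {1..n}\<close>, of j] that xs(1) \<open>i \<in> {1..n}\<close> by (auto simp: support_def)
        moreover have "1 \<le> h" using h by simp
        ultimately have "j = q h" using only i by blast
        then show False using that by simp
      qed
      then have "(\<Sum>j\<in>{1..k} - {q h}. X i j) = 0" by (intro sum.neutral) blast
      then show ?thesis
        using row_sum[OF \<open>i \<in> {1..n}\<close>] sum.remove[of "{1..k}" "q h" "X i"] q by simp
    qed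
    have empty: "X i j = 0"
      if "j \<in> {1..k}" "i \<in> {1..n} - (\<Union>h\<in>{h\<in>{1..2 * k - 1}. q h = j}. {l (h - 1)..l h})" for i j
    proof (rule ccontr)
      assume "X i j \<noteq> 0"
      then have "(i, j) \<in> set xs" using that X_nonneg[of i j] xs(1) by (auto simp: support_def)
      from bspec[OF cover this, unfolded k_eq] obtain h
        where "h \<in> {1..2 * k - 1}" "q h = j" "l (h - 1) \<le> i" "i \<le> l h" by auto
      then show False using that by auto
    qed
    have unit: "X i j \<in> {0..1}" if "i \<in> {1..n}" "j \<in> {1..k}" for i j
      using X_nonneg X_le_1 that by auto
    show ?thesis
    proof (rule exI[of _ l], rule exI[of _ q], intro conjI ballI allI impI)
      show "l (2 * k - 1) = n + 1" using l(2) unfolding k_eq .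
      show "X i (q h) = 1" if "h \<in> {1..2 * k - 1}" "l (h - 1) < i \<and> i < l h" for h i
        using full that by blast
    qed (use l(1) in simp, use l(3) in simp, use q in blast, use empty in blast, use unit in blast)
  qed
qed

end
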